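(* Let $X$ be an infinite-dimensional separable complex Banach space. There exists a sequence $(T_n)_{n\in\mathbb{N}}$ of continuous linear operators on $X$ which is densely Li--Yorke chaotic but does not admit a dense irregular manifold.
   Context: Let $(T_n)_{n\in\mathbb{N}}$ be a sequence of continuous linear operators $X\to X$. A vector $x\in X$ is irregular for $(T_n)_n$ if $\liminf_{n\to\infty}\|T_nx\|=0$ and $\limsup_{n\to\infty}\|T_nx\|=\infty$. The sequence $(T_n)_n$ is densely Li--Yorke chaotic if there exists an uncountable dense set $\Gamma\subset X$ such that $p-q$ is irregular for $(T_n)_n$ for all $p,q\in\Gamma$ with $p\neq q$. The sequence admits a dense irregular manifold if there is a dense vector subspace of $X$ all of whose non-zero vectors are irregular for $(T_n)_n$. *)

theory Defs
  imports "HOL-Analysis.Analysis"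
begin

text \<open>The real normed structure of the class hierarchy is the underlying real structure
  of the complex space: \<open>scaleR_scaleC\<close> ties the two scalar multiplications together.\<close>

class complex_normed_vector = real_normed_vector +
  fixes scaleC :: "complex \<Rightarrow> 'a \<Rightarrow> 'a" (infixr \<open>*\<^sub>C\<close> 75)
  assumes scaleC_add_right: "a *\<^sub>C (x + y) = a *\<^sub>C x + a *\<^sub>C y"
    and scaleC_add_left: "(a + b) *\<^sub>C x = a *\<^sub>C x + b *\<^sub>C x"
    and scaleC_scaleC: "a *\<^sub>C b *\<^sub>C x = (a * b) *\<^sub>C x"
    and scaleC_one: "1 *\<^sub>C x = x"
    and scaleR_scaleC: "r *\<^sub>R x = complex_of_real r *\<^sub>C x"
    and norm_scaleC: "norm (a *\<^sub>C x) = cmod a * norm x"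

class complex_banach = complex_normed_vector + banach

global_interpretation complex_vector:
  vector_space "scaleC :: complex \<Rightarrow> 'a \<Rightarrow> 'a :: complex_normed_vector"
  by unfold_locales (simp_all add: scaleC_add_right scaleC_add_left scaleC_scaleC scaleC_one)

definition infinite_dimensional :: "'a::complex_normed_vector itself \<Rightarrow> bool" where
  "infinite_dimensional _ \<longleftrightarrow> \<not> (\<exists>B :: 'a set. finite B \<and> complex_vector.span B = UNIV)"

definition continuous_clinear :: "('a::complex_normed_vector \<Rightarrow> 'a) \<Rightarrow> bool" where
  "continuous_clinear f \<longleftrightarrow> Vector_Spaces.linear scaleC scaleC f \<and> continuous_on UNIV f"

definition irregular :: "(nat \<Rightarrow> 'a::complex_normed_vector \<Rightarrow> 'a) \<Rightarrow> 'a \<Rightarrow> bool" where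
  "irregular T x \<longleftrightarrow>
     liminf (\<lambda>n. ereal (norm (T n x))) = 0 \<and> limsup (\<lambda>n. ereal (norm (T n x))) = \<infinity>"

definition densely_Li_Yorke_chaotic ::
  "(nat \<Rightarrow> 'a::complex_normed_vector \<Rightarrow> 'a) \<Rightarrow> bool" where
  "densely_Li_Yorke_chaotic T \<longleftrightarrow>
     (\<exists>\<Gamma>. uncountable \<Gamma> \<and> closure \<Gamma> = UNIV \<and>
        (\<forall>p\<in>\<Gamma>. \<forall>q\<in>\<Gamma>. p \<noteq> q \<longrightarrow> irregular T (p - q)))"

definition admits_dense_irregular_manifold ::
  "(nat \<Rightarrow> 'a::complex_normed_vector \<Rightarrow> 'a) \<Rightarrow> bool" where
  "admits_dense_irregular_manifold T \<longleftrightarrow>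
     (\<exists>M. complex_vector.subspace M \<and> closure M = UNIV \<and>
        (\<forall>x\<in>M. x \<noteq> 0 \<longrightarrow> irregular T x))"

end

theory Submission
  imports Defs
begin

text \<open>Take a non-zero continuous functional \<open>\<phi>\<close>, a vector \<open>e \<noteq> 0\<close>, and the rank-one operators
  \<open>T\<^sub>n x = c\<^sub>n \<phi>(x) e\<close>, where \<open>c\<^sub>n\<close> is \<open>n\<close> for even \<open>n\<close> and \<open>0\<close> for odd \<open>n\<close>. Then \<open>x\<close> is irregular
  iff \<open>\<phi> x \<noteq> 0\<close>, so a dense uncountable set on which \<open>\<phi>\<close> is injective witnesses dense Li--Yorke
  chaos. On an irregular manifold \<open>\<phi>\<close> would be injective as well, which makes the manifold at most
  one-dimensional and hence not dense.\<close>

section \<open>Sublinear functionals: infima and minimal elements\<close>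

text \<open>Domination by the norm is part of the notion, so that it passes to pointwise infima and makes
  every linear instance continuous.\<close>

definition sublinear :: "('a::real_normed_vector \<Rightarrow> real) \<Rightarrow> bool" where
  "sublinear p \<longleftrightarrow> (\<forall>x y. p (x + y) \<le> p x + p y) \<and>
     (\<forall>r x. r \<ge> 0 \<longrightarrow> p (r *\<^sub>R x) = r * p x) \<and> (\<forall>x. p x \<le> norm x)"

lemma sublinear_zero:
  assumes "sublinear p"
  shows "p 0 = 0"
proof -
  have "p (0 *\<^sub>R 0) = 0 * p 0"
    using assms unfolding sublinear_def by blast
  then show ?thesis by simp
qed

lemma sublinear_add: "sublinear p \<Longrightarrow> p (x + y) \<le> p x + p y"
  and sublinear_scaleR: "sublinear p \<Longrightarrow> r \<ge> 0 \<Longrightarrow> p (r *\<^sub>R x) = r * p x"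
  and sublinear_le_norm: "sublinear p \<Longrightarrow> p x \<le> norm x"
  unfolding sublinear_def by blast+

lemma sublinear_minus_ge:
  assumes "sublinear p"
  shows "- p (- x) \<le> p x"
  using sublinear_add[OF assms, of x "- x"] sublinear_zero[OF assms] by simp

lemma sublinear_ge_norm:
  assumes "sublinear p"
  shows "- norm x \<le> p x"
  using sublinear_minus_ge[OF assms, of x] sublinear_le_norm[OF assms, of "- x"] by simp

lemma sublinear_norm: "sublinear norm"
  by (simp add: sublinear_def norm_triangle_ineq)

text \<open>The index may change in \<open>add\<close> and \<open>scale\<close>, so the members need
  not be sublinear one by one. This serves both the one-parameter family of
  \<open>sublinear_decrease\<close> and chains, where the smaller of two members works.\<close>

lemma sublinear_INF:
  assumes ne: "I \<noteq> {}"
    and lower: "\<And>x. bdd_below ((\<lambda>i. q i x) ` I)"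
    and le: "\<And>x. \<exists>i\<in>I. q i x \<le> norm x"
    and add: "\<And>i j x y. i \<in> I \<Longrightarrow> j \<in> I \<Longrightarrow> \<exists>k\<in>I. q k (x + y) \<le> q i x + q j y"
    and scale: "\<And>i r x. i \<in> I \<Longrightarrow> r > 0 \<Longrightarrow> \<exists>k\<in>I. q k (r *\<^sub>R x) \<le> r * q i x"
    and zero: "\<And>i. i \<in> I \<Longrightarrow> q i 0 = 0"
  shows "sublinear (\<lambda>x. INF i\<in>I. q i x)"
proof -
  let ?p = "\<lambda>x. INF i\<in>I. q i x"
  have low: "?p x \<le> q i x" if "i \<in> I" for i x
    using that by (intro cINF_lower lower)
  have p_scale_le: "?p (r *\<^sub>R x) \<le> r * ?p x" if r: "r > 0" for r x
  proof -
    have "?p (r *\<^sub>R x) / r \<le> ?p x"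
    proof (rule cINF_greatest[OF ne])
      fix i assume "i \<in> I"
      then obtain k where "k \<in> I" "q k (r *\<^sub>R x) \<le> r * q i x"
        using scale r by blast
      then have "?p (r *\<^sub>R x) \<le> r * q i x"
        using low[of k "r *\<^sub>R x"] by linarith
      then show "?p (r *\<^sub>R x) / r \<le> q i x"
        using r by (simp add: field_simps)
    qed
    then show ?thesis
      using r by (simp add: field_simps)
  qed
  have p_scale: "?p (r *\<^sub>R x) = r * ?p x" if r: "r \<ge> 0" for r x
  proof (cases "r = 0")
    case True
    have "?p 0 = 0"
      using zero ne by simp
    then show ?thesis using True by simp
  next
    case False
    then have r: "r > 0" using r by simp
    \<comment> \<open>The reverse inequality is \<open>p_scale_le\<close> at the scale
      \<open>inverse r\<close>.\<close>
    have "?p (inverse r *\<^sub>R r *\<^sub>R x) \<le> inverse r * ?p (r *\<^sub>R x)"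
      using p_scale_le[of "inverse r" "r *\<^sub>R x"] r by simp
    then have "r * ?p x \<le> ?p (r *\<^sub>R x)"
      using r by (simp add: field_simps)
    with p_scale_le[OF r] show ?thesis
      by (simp add: order.antisym)
  qed
  have p_add: "?p (x + y) \<le> ?p x + ?p y" for x y
  proof -
    have "?p (x + y) - ?p y \<le> q i x" if i: "i \<in> I" for i
    proof -
      have "?p (x + y) - q i x \<le> ?p y"
      proof (rule cINF_greatest[OF ne])
        fix j assume "j \<in> I"
        then obtain k where "k \<in> I" "q k (x + y) \<le> q i x + q j y"
          using add i by blast
        then show "?p (x + y) - q i x \<le> q j y"
          using low[of k "x + y"] by linarith
      qed
      then show ?thesis by linarith
    qed
    then have "?p (x + y) - ?p y \<le> ?p x"
      by (intro cINF_greatest[OF ne])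
    then show ?thesis by linarith
  qed
  have "?p x \<le> norm x" for x
    using le[of x] low[of _ x] order_trans by blast
  with p_add p_scale show ?thesis
    unfolding sublinear_def by blast
qed

text \<open>The infimum of \<open>p (x + t y) - t p(y)\<close> over \<open>t \<ge> 0\<close> is again sublinear. It forces a minimal
  sublinear functional to be odd, hence linear, which replaces the one-step extension in the usual
  proof of the Hahn--Banach theorem.\<close>

lemma sublinear_decrease:
  assumes p: "sublinear p"
  obtains q where "sublinear q" "\<And>x. q x \<le> p x" "q (- y) \<le> - p y"
proof
  let ?g = "\<lambda>t x. p (x + t *\<^sub>R y) - t * p y"
  let ?q = "\<lambda>x. INF t\<in>{0::real..}. ?g t x"
  \<comment> \<open>A bound free of \<open>t\<close>, from splitting \<open>t *\<^sub>R y\<close>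
    into \<open>x + t *\<^sub>R y\<close> and \<open>- x\<close>; it keeps the infimum
    finite.\<close>
  have lower: "- p (- x) \<le> ?g t x" if "t \<ge> 0" for t x
    using sublinear_add[OF p, of "x + t *\<^sub>R y" "- x"] sublinear_scaleR[OF p that, of y] by simp
  have bdd: "bdd_below ((\<lambda>t. ?g t x) ` {0..})" for x
    using lower by (intro bdd_belowI[of _ "- p (- x)"]) auto
  show "sublinear ?q"
  proof (rule sublinear_INF)
    show "\<exists>i\<in>{0..}. ?g i x \<le> norm x" for x
      using sublinear_le_norm[OF p] by (intro bexI[of _ 0]) auto
    show "\<exists>k\<in>{0..}. ?g k (x + z) \<le> ?g i x + ?g j z" if "i \<in> {0..}" "j \<in> {0..}" for i j x z
      using that sublinear_add[OF p, of "x + i *\<^sub>R y" "z + j *\<^sub>R y"]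
      by (intro bexI[of _ "i + j"]) (auto simp: algebra_simps)
    show "\<exists>k\<in>{0..}. ?g k (r *\<^sub>R x) \<le> r * ?g i x" if "i \<in> {0..}" "r > 0" for i r x
      using that sublinear_scaleR[OF p, of r "x + i *\<^sub>R y"]
      by (intro bexI[of _ "r * i"]) (auto simp: algebra_simps)
    show "?g i 0 = 0" if "i \<in> {0..}" for i
      using that sublinear_scaleR[OF p] by simp
  qed (use bdd in auto)
  show "?q x \<le> p x" for x
    using cINF_lower[OF bdd, of 0 x] by simp
  \<comment> \<open>At \<open>t = 1\<close> the argument \<open>- y + y\<close> vanishes, leaving
    \<open>p 0 - p y\<close>.\<close>
  show "?q (- y) \<le> - p y"
    using cINF_lower[OF bdd, of 1 "- y"] sublinear_zero[OF p] by simp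
qed

text \<open>Zorn's lemma for the reversed order: a nonempty chain is bounded below by its pointwise
  infimum, which is finite because each sublinear functional stays above
  \<open>- norm x\<close>.\<close>

lemma minimal_sublinear_below:
  assumes p: "sublinear p"
  obtains m where "sublinear m" "m \<le> p" "\<And>q. sublinear q \<Longrightarrow> q \<le> m \<Longrightarrow> q = m"
proof -
  let ?A = "{q. sublinear q \<and> q \<le> p}"
  let ?r = "relation_of (\<lambda>f g. g \<le> f) ?A"
  have "\<exists>m\<in>?A. \<forall>a\<in>?A. a \<le> m \<longrightarrow> a = m"
  proof (rule predicate_Zorn)
    show "partial_order_on ?A ?r"
      by (rule partial_order_on_relation_ofI) auto
    fix C assume C: "C \<in> Chains ?r"
    show "\<exists>u\<in>?A. \<forall>a\<in>C. u \<le> a"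
    proof (cases "C = {}")
      case True
      then show ?thesis using p by auto
    next
      case False
      have CA: "C \<subseteq> ?A"
        using C by (auto simp: Chains_def relation_of_def)
      have lin: "f \<le> g \<or> g \<le> f" if "f \<in> C" "g \<in> C" for f g
        using C that by (auto simp: Chains_def relation_of_def)
      let ?u = "\<lambda>x. INF f\<in>C. f x"
      have bdd: "bdd_below ((\<lambda>f. f x) ` C)" for x
        using CA sublinear_ge_norm by (intro bdd_belowI[of _ "- norm x"]) auto
      have "sublinear ?u"
      proof (rule sublinear_INF[OF False bdd])
        show "\<exists>f\<in>C. f x \<le> norm x" for x
          using False CA sublinear_le_norm by blast
        show "\<exists>k\<in>C. k (x + y) \<le> f x + g y" if fg: "f \<in> C" "g \<in> C" for f g x y
        proof -
          obtain k where k: "k \<in> C" "k \<le> f" "k \<le> g"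
            using lin[OF fg] fg by blast
          then have "k (x + y) \<le> k x + k y"
            using CA sublinear_add by blast
          also have "\<dots> \<le> f x + g y"
            using k by (intro add_mono) (auto simp: le_fun_def)
          finally show ?thesis using k by blast
        qed
        show "\<exists>k\<in>C. k (r *\<^sub>R x) \<le> r * f x" if "f \<in> C" "r > 0" for f r x
          using that CA sublinear_scaleR[of f r x] by (intro bexI[of _ f]) auto
        show "f 0 = 0" if "f \<in> C" for f
          using that CA sublinear_zero by blast
      qed
      moreover have low: "?u \<le> f" if "f \<in> C" for f
        using that by (auto intro!: le_funI cINF_lower bdd)
      moreover have "?u \<le> p"
        using False CA low order_trans by blast
      ultimately show ?thesis by blast
    qed
  qed
  then obtain m where m: "m \<in> ?A" "\<forall>a\<in>?A. a \<le> m \<longrightarrow> a = m" by blast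
  show ?thesis
  proof (rule that[of m])
    show "q = m" if "sublinear q" "q \<le> m" for q
      using m that order_trans by blast
  qed (use m in auto)
qed

section \<open>Continuous functionals that do not vanish at a given vector\<close>

text \<open>A minimal sublinear functional is linear. Starting below \<open>norm\<close> decreased
  in the direction \<open>e\<close>, instead of at \<open>norm\<close>, keeps the minimal one from
  vanishing at \<open>e\<close>.\<close>

lemma exists_real_functional_nonzero:
  fixes e :: "'a::real_normed_vector"
  assumes "e \<noteq> 0"
  obtains f :: "'a \<Rightarrow> real" where "bounded_linear f" "f e \<noteq> 0"
proof -
  obtain q where q: "sublinear q" "q (- e) \<le> - norm e"
    using sublinear_decrease[OF sublinear_norm, of e] by metis
  obtain f where f: "sublinear f" "f \<le> q" and min: "\<And>g. sublinear g \<Longrightarrow> g \<le> f \<Longrightarrow> g = f"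
    using minimal_sublinear_below[OF q(1)] by metis
  have neg: "f (- y) = - f y" for y
  proof -
    obtain g where g: "sublinear g" "\<And>x. g x \<le> f x" "g (- y) \<le> - f y"
      using sublinear_decrease[OF f(1), of y] by metis
    \<comment> \<open>Minimality turns the decrease of \<open>f\<close> into the inequality
      \<open>f (- y) \<le> - f y\<close>.\<close>
    then have "g = f" using min by (simp add: le_fun_def)
    then show ?thesis
      using g(3) sublinear_minus_ge[OF f(1), of y] by simp
  qed
  \<comment> \<open>By oddness, subadditivity at \<open>- x\<close> and \<open>- y\<close> is
    superadditivity at \<open>x\<close> and \<open>y\<close>.\<close>
  have add: "f (x + y) = f x + f y" for x y
    using sublinear_add[OF f(1), of x y] sublinear_add[OF f(1), of "- x" "- y"]
      neg[of x] neg[of y] neg[of "x + y"] by simp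
  have scale: "f (r *\<^sub>R x) = r * f x" for r x
    using sublinear_scaleR[OF f(1), of r x] sublinear_scaleR[OF f(1), of "- r" x] neg[of "r *\<^sub>R x"]
    by (cases "r \<ge> 0") auto
  have "\<bar>f x\<bar> \<le> norm x" for x
    using sublinear_le_norm[OF f(1), of x] sublinear_ge_norm[OF f(1), of x] by linarith
  then have "bounded_linear f"
    by (intro bounded_linear_intro[of _ 1]) (simp_all add: add scale)
  moreover have "f (- e) \<le> - norm e"
    using f(2) q(2) by (force simp: le_fun_def intro: order_trans)
  then have "f e \<noteq> 0"
    using neg[of e] assms by auto
  ultimately show ?thesis using that by blast
qed

lemma bounded_linear_scaleC_right: "bounded_linear (\<lambda>x::'a::complex_normed_vector. c *\<^sub>C x)"
proof (rule bounded_linear_intro[of _ "cmod c"])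
  show "c *\<^sub>C (r *\<^sub>R x) = r *\<^sub>R (c *\<^sub>C x)" for r and x :: 'a
    by (simp add: scaleR_scaleC mult.commute)
qed (simp_all add: scaleC_add_right norm_scaleC mult.commute)

lemma bounded_linear_scaleC_left: "bounded_linear (\<lambda>c. c *\<^sub>C (x::'a::complex_normed_vector))"
proof (rule bounded_linear_intro[of _ "norm x"])
  show "(r *\<^sub>R c) *\<^sub>C x = r *\<^sub>R (c *\<^sub>C x)" for r c
    by (simp add: scaleR_scaleC scaleR_conv_of_real)
qed (simp_all add: scaleC_add_left norm_scaleC)

text \<open>The standard complexification: a complex functional is determined by its real part
  \<open>f\<close>, here chosen with \<open>f e \<noteq> 0\<close>.\<close>

lemma exists_complex_functional_nonzero:
  fixes e :: "'a::complex_normed_vector"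
  assumes "e \<noteq> 0"
  obtains \<phi> :: "'a \<Rightarrow> complex" where "bounded_linear \<phi>"
    "\<And>c x. \<phi> (c *\<^sub>C x) = c * \<phi> x" "\<phi> e \<noteq> 0"
proof -
  obtain f :: "'a \<Rightarrow> real" where f: "bounded_linear f" "f e \<noteq> 0"
    using exists_real_functional_nonzero[OF assms] by metis
  interpret f: bounded_linear f by (fact f(1))
  define \<phi> where "\<phi> x = complex_of_real (f x) - \<i> * complex_of_real (f (\<i> *\<^sub>C x))" for x
  have "bounded_linear \<phi>"
    unfolding \<phi>_def
    by (intro bounded_linear_sub bounded_linear_compose[OF bounded_linear_mult_right]
        bounded_linear_compose[OF bounded_linear_of_real]
        bounded_linear_compose[OF f(1)] bounded_linear_scaleC_right bounded_linear_ident)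
  moreover have "\<phi> (c *\<^sub>C x) = c * \<phi> x" for c x
  proof -
    have split: "f (d *\<^sub>C x) = Re d * f x + Im d * f (\<i> *\<^sub>C x)" for d
    proof -
      have "d *\<^sub>C x = Re d *\<^sub>R x + Im d *\<^sub>R (\<i> *\<^sub>C x)"
        using complex_eq[of d]
        by (metis scaleR_scaleC scaleC_add_left scaleC_scaleC mult.commute)
      then show ?thesis by (simp add: f.add f.scaleR)
    qed
    show ?thesis
      using split[of c] split[of "\<i> * c"]
      by (simp add: \<phi>_def complex_eq_iff algebra_simps)
  qed
  moreover have "Re (\<phi> e) = f e" by (simp add: \<phi>_def)
  then have "\<phi> e \<noteq> 0" using f(2) by auto
  ultimately show ?thesis using that by blast
qed

section \<open>A criterion for irregularity, and a dense sequence separated by a functional\<close>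

lemma irregular_if_norm_alternating:
  fixes T :: "nat \<Rightarrow> 'a::complex_normed_vector \<Rightarrow> 'a"
  assumes T: "\<And>n. norm (T n x) = (if even n then real n * K else 0)" and "K > 0"
  shows "irregular T x"
proof -
  let ?u = "\<lambda>n. ereal (norm (T n x))"
  have "liminf ?u \<le> liminf (?u \<circ> (\<lambda>n. 2 * n + 1))"
    by (rule liminf_subseq_mono) (simp add: strict_mono_def)
  also have "?u \<circ> (\<lambda>n. 2 * n + 1) = (\<lambda>_. 0)"
    by (auto simp: T)
  finally have "liminf ?u \<le> 0"
    by (simp add: Liminf_const)
  moreover have "0 \<le> liminf ?u"
    by (rule Liminf_bounded) simp
  moreover have "limsup (?u \<circ> (\<lambda>n. 2 * n)) \<le> limsup ?u"
    by (rule limsup_subseq_mono) (simp add: strict_mono_def)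
  moreover have "filterlim (\<lambda>n. real (2 * n) * K) at_top sequentially"
    by (rule filterlim_at_top_mult_tendsto_pos[OF tendsto_const \<open>K > 0\<close>])
      (intro filterlim_compose[OF filterlim_real_sequentially] mult_nat_left_at_top, simp)
  then have "(?u \<circ> (\<lambda>n. 2 * n)) \<longlonglongrightarrow> \<infinity>"
    unfolding comp_def T by (simp add: tendsto_PInfty_eq_at_top)
  then have "limsup (?u \<circ> (\<lambda>n. 2 * n)) = \<infinity>"
    by (intro lim_imp_Limsup) auto
  ultimately show ?thesis
    unfolding irregular_def by auto
qed

text \<open>Points of a countable dense set are shifted along \<open>e\<close>, where the functional
  varies, by amounts tending to zero.\<close>

lemma dense_seq_injective_functional:
  fixes \<phi> :: "'a::complex_normed_vector \<Rightarrow> complex"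
  assumes \<phi>: "bounded_linear \<phi>" "\<And>c x. \<phi> (c *\<^sub>C x) = c * \<phi> x" "\<phi> e \<noteq> 0"
    and sep: "separable_space (euclidean :: 'a topology)"
  obtains x :: "nat \<Rightarrow> 'a" where "closure (range x) = UNIV" "inj (\<phi> \<circ> x)"
proof -
  interpret \<phi>: bounded_linear \<phi> by (fact \<phi>(1))
  obtain D :: "'a set" where D: "countable D" "closure D = UNIV"
    using sep unfolding separable_space_def by auto
  define d where "d N = from_nat_into D (fst (prod_decode N))" for N
  define \<delta> where "\<delta> N = inverse (real (Suc N))" for N
  \<comment> \<open>Equal values of \<open>\<phi>\<close> at the shifted points \<open>N\<close> and
    \<open>M\<close> give an equation linear in \<open>t\<close>; for \<open>N \<noteq> M\<close>
    this is its only possible real solution. The diagonal adds only 0, the value of division by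
    zero.\<close>
  define bad where
    "bad = (\<lambda>(N, M). Re ((\<phi> (d N) - \<phi> (d M)) / (complex_of_real (\<delta> M - \<delta> N) * \<phi> e))) ` UNIV"
  have "countable bad"
    unfolding bad_def by auto
  then have "bad \<noteq> UNIV"
    using uncountable_UNIV_real by auto
  then obtain t where t: "t \<notin> bad" by blast
  \<comment> \<open>Every point of \<open>D\<close> occurs infinitely often among the \<open>d N\<close>, so the vanishing perturbation
    keeps the sequence dense; \<open>t\<close> avoids the countably many values producing a collision.\<close>
  define x where "x N = d N + complex_of_real (t * \<delta> N) *\<^sub>C e" for N
  have \<phi>x: "\<phi> (x N) = \<phi> (d N) + complex_of_real (t * \<delta> N) * \<phi> e" for N
    by (simp add: x_def \<phi>.add \<phi>(2))
  have "inj (\<phi> \<circ> x)"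
  proof (rule injI, rule ccontr)
    fix N M assume eq: "(\<phi> \<circ> x) N = (\<phi> \<circ> x) M" and "N \<noteq> M"
    then have "\<delta> M - \<delta> N \<noteq> 0" by (simp add: \<delta>_def)
    then have nz: "complex_of_real (\<delta> M - \<delta> N) * \<phi> e \<noteq> 0"
      using \<phi>(3) by (metis mult_eq_0_iff of_real_eq_0_iff)
    have "\<phi> (d N) - \<phi> (d M) = complex_of_real t * (complex_of_real (\<delta> M - \<delta> N) * \<phi> e)"
      using eq by (simp add: \<phi>x algebra_simps)
    then have "complex_of_real t = (\<phi> (d N) - \<phi> (d M)) / (complex_of_real (\<delta> M - \<delta> N) * \<phi> e)"
      by (metis nonzero_mult_div_cancel_right nz)
    then have "t = Re ((\<phi> (d N) - \<phi> (d M)) / (complex_of_real (\<delta> M - \<delta> N) * \<phi> e))"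
      by (metis Re_complex_of_real)
    then have "t \<in> bad"
      unfolding bad_def by (intro image_eqI[of _ _ "(N, M)"]) auto
    with t show False ..
  qed
  moreover have "D \<subseteq> closure (range x)"
  proof
    fix y assume "y \<in> D"
    then obtain n where n: "from_nat_into D n = y"
      using from_nat_into_surj D(1) by metis
    let ?N = "\<lambda>k. prod_encode (n, k)"
    have "filterlim ?N sequentially sequentially"
      by (rule filterlim_at_top_mono[OF filterlim_ident]) (simp add: le_prod_encode_2)
    then have "(\<lambda>k. \<delta> (?N k)) \<longlonglongrightarrow> 0"
      unfolding \<delta>_def using LIMSEQ_inverse_real_of_nat by (rule filterlim_compose[rotated])
    then have "(\<lambda>k. complex_of_real (t * \<delta> (?N k))) \<longlonglongrightarrow> complex_of_real (t * 0)"
      by (intro tendsto_intros)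
    then have "(\<lambda>k. y + complex_of_real (t * \<delta> (?N k)) *\<^sub>C e) \<longlonglongrightarrow> y + complex_of_real (t * 0) *\<^sub>C e"
      by (intro tendsto_add tendsto_const bounded_linear.tendsto[OF bounded_linear_scaleC_left])
    then have "(\<lambda>k. x (?N k)) \<longlonglongrightarrow> y"
      by (simp add: x_def d_def n)
    then show "y \<in> closure (range x)"
      unfolding closure_sequential by (intro exI[of _ "\<lambda>k. x (?N k)"]) auto
  qed
  then have "closure (range x) = UNIV"
    using D(2) by (metis closure_closure closure_mono top.extremum_uniqueI)
  ultimately show ?thesis using that by blast
qed

section \<open>The sequence of rank-one operators\<close>

theorem theorem4p2:
  assumes "infinite_dimensional TYPE('a::complex_banach)"
    and "separable_space (euclidean :: 'a topology)"
  shows "\<exists>T :: nat \<Rightarrow> 'a \<Rightarrow> 'a.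
           (\<forall>n. continuous_clinear (T n)) \<and>
           densely_Li_Yorke_chaotic T \<and> \<not> admits_dense_irregular_manifold T"
proof -
  have not_span: "complex_vector.span B \<noteq> UNIV" if "finite B" for B :: "'a set"
    using assms(1) that unfolding infinite_dimensional_def by blast
  obtain e :: 'a where e: "e \<noteq> 0"
    using not_span[of "{}"] by auto
  obtain \<phi> :: "'a \<Rightarrow> complex" where \<phi>: "bounded_linear \<phi>"
    "\<And>c x. \<phi> (c *\<^sub>C x) = c * \<phi> x" "\<phi> e \<noteq> 0"
    using exists_complex_functional_nonzero[OF e] by metis
  interpret \<phi>: bounded_linear \<phi> by (fact \<phi>(1))
  define T :: "nat \<Rightarrow> 'a \<Rightarrow> 'a" where
    "T n x = ((if even n then of_nat n else 0) * \<phi> x) *\<^sub>C e" for n x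
  have T_ker: "\<not> irregular T x" if "\<phi> x = 0" for x
    by (simp add: irregular_def T_def that Limsup_const)
  have T_irr: "irregular T x" if "\<phi> x \<noteq> 0" for x
    by (rule irregular_if_norm_alternating[where K = "cmod (\<phi> x) * norm e"])
      (use that e in \<open>auto simp: T_def norm_scaleC norm_mult\<close>)
  have "continuous_clinear (T n)" for n
    unfolding continuous_clinear_def
  proof
    show "Vector_Spaces.linear (*\<^sub>C) (*\<^sub>C) (T n)"
      by unfold_locales
        (simp_all add: T_def \<phi>.add \<phi>(2) distrib_left scaleC_add_left mult.left_commute)
    have "bounded_linear (T n)"
      unfolding T_def
      by (intro bounded_linear_compose[OF bounded_linear_scaleC_left]
          bounded_linear_compose[OF bounded_linear_mult_right] \<phi>(1))
    then show "continuous_on UNIV (T n)"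
      by (rule linear_continuous_on)
  qed
  moreover have "densely_Li_Yorke_chaotic T"
  proof -
    obtain x :: "nat \<Rightarrow> 'a" where x: "closure (range x) = UNIV" "inj (\<phi> \<circ> x)"
      using dense_seq_injective_functional[OF \<phi> assms(2)] by metis
    \<comment> \<open>The sequence gives density and the line through \<open>e\<close>
      uncountability. Removing the scalars \<open>c\<close> for which
      \<open>\<phi> (c *\<^sub>C e)\<close> is some \<open>\<phi> (x n)\<close> keeps
      \<open>\<phi>\<close> injective on the union.\<close>
    define C where "C = UNIV - (\<lambda>n. \<phi> (x n) / \<phi> e) ` UNIV"
    define \<Gamma> where "\<Gamma> = range x \<union> (\<lambda>c. c *\<^sub>C e) ` C"
    have "uncountable C"
      unfolding C_def by (intro uncountable_minus_countable uncountable_UNIV_complex) auto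
    moreover have "inj_on (\<lambda>c. c *\<^sub>C e) C"
      using e by (auto simp: inj_on_def)
    ultimately have "uncountable \<Gamma>"
      unfolding \<Gamma>_def using countable_image_inj_on countable_Un_iff by blast
    moreover have "closure \<Gamma> = UNIV"
      using x(1) closure_mono[of "range x" \<Gamma>] by (auto simp: \<Gamma>_def)
    moreover have "inj_on \<phi> \<Gamma>"
    proof -
      have "\<phi> (x n) \<noteq> \<phi> (c *\<^sub>C e)" if "c \<in> C" for c n
      proof
        assume "\<phi> (x n) = \<phi> (c *\<^sub>C e)"
        then have "c = \<phi> (x n) / \<phi> e"
          using \<phi>(2,3) by simp
        then show False
          using that by (auto simp: C_def)
      qed
      moreover have "inj_on \<phi> (range x)"
        using x(2) by (simp add: inj_on_imageI)
      moreover have "inj_on \<phi> ((\<lambda>c. c *\<^sub>C e) ` C)"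
        using \<phi>(2,3) by (auto simp: inj_on_def)
      ultimately show ?thesis
        unfolding \<Gamma>_def inj_on_Un by fastforce
    qed
    then have "irregular T (p - q)" if "p \<in> \<Gamma>" "q \<in> \<Gamma>" "p \<noteq> q" for p q
      using that by (intro T_irr) (auto simp: \<phi>.diff inj_on_def)
    ultimately show ?thesis
      unfolding densely_Li_Yorke_chaotic_def by blast
  qed
  moreover have "\<not> admits_dense_irregular_manifold T"
  proof
    assume "admits_dense_irregular_manifold T"
    then obtain M where M: "complex_vector.subspace M" "closure M = UNIV"
      and irr: "\<forall>x\<in>M. x \<noteq> 0 \<longrightarrow> irregular T x"
      unfolding admits_dense_irregular_manifold_def by (elim exE conjE)
    have inj: "x = 0" if "x \<in> M" "\<phi> x = 0" for x
      using irr T_ker[OF that(2)] that(1) by auto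
    have "closed {y. \<phi> y = 0}"
      by (intro closed_Collect_eq linear_continuous_on \<phi>(1) continuous_on_const)
    \<comment> \<open>The kernel is closed and misses \<open>e\<close>, so it cannot contain a dense
      set.\<close>
    then have "\<not> M \<subseteq> {y. \<phi> y = 0}"
      using closure_minimal[of M "{y. \<phi> y = 0}"] M(2) \<phi>(3) by auto
    then obtain m where m: "m \<in> M" "\<phi> m \<noteq> 0" by auto
    \<comment> \<open>Since \<open>\<phi> m \<noteq> 0\<close>, the equation says that
      \<open>y\<close> is a multiple of \<open>m\<close>. Being a closed condition, it passes from
      \<open>M\<close> to the whole space.\<close>
    let ?E = "{y. \<phi> m *\<^sub>C y = \<phi> y *\<^sub>C m}"
    have "closed ?E"
      by (intro closed_Collect_eq linear_continuous_on bounded_linear_scaleC_right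
          bounded_linear_compose[OF bounded_linear_scaleC_left \<phi>(1)])
    moreover have "M \<subseteq> ?E"
    proof
      fix y assume y: "y \<in> M"
      \<comment> \<open>This combination lies in \<open>M\<close> and is annihilated by
        \<open>\<phi>\<close>.\<close>
      have "\<phi> m *\<^sub>C y - \<phi> y *\<^sub>C m = 0"
        using M(1) y m(1)
        by (intro inj complex_vector.subspace_diff complex_vector.subspace_scale)
          (simp_all add: \<phi>.diff \<phi>(2) mult.commute)
      then show "y \<in> ?E" by simp
    qed
    ultimately have E: "?E = UNIV"
      using closure_minimal[of M ?E] M(2) by auto
    have "y \<in> complex_vector.span {m}" for y
    proof -
      have "\<phi> m *\<^sub>C y = \<phi> y *\<^sub>C m"
        using E by blast
      then have "inverse (\<phi> m) *\<^sub>C \<phi> m *\<^sub>C y = inverse (\<phi> m) *\<^sub>C \<phi> y *\<^sub>C m"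
        by (rule arg_cong)
      then have "y = (inverse (\<phi> m) * \<phi> y) *\<^sub>C m"
        using m(2) by simp
      then show ?thesis
        by (metis complex_vector.span_base complex_vector.span_scale singletonI)
    qed
    then show False
      using not_span[of "{m}"] by auto
  qed
  ultimately show ?thesis by blast
qed

end
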